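(* Let $n\ge 1$ be an integer. The factorial posets $P$ on $[n]$ such that for each $i\in[n-1]$ we have $$\mathrm{pred}(i)\le \mathrm{pred}(i+1)\quad\text{or}\quad \mathrm{succ}(i)>\mathrm{succ}(i+1)$$ are in bijection with unlabeled $(\mathbf{2}+\mathbf{2})$-free posets on $n$ nodes; hence there are exactly $\mathfrak{f}_n$ such factorial posets, where $\mathfrak{f}_n$ is the $n$th Fishburn number.
   Context: $[n]=\{1,\dots,n\}$. A poset $P$ on $[n]$ (with strict order $<_P$) is naturally labeled if $i<_P j$ implies $i<j$ in the usual order of integers. A factorial poset on $[n]$ is a naturally labeled poset $P$ on $[n]$ such that for all $i,j,k\in[n]$: if $i<j$ (usual order) and $j<_P k$, then $i<_P k$. For $j\in P$, $\mathrm{pred}(j)=\#\{i: i<_P j\}$ and $\mathrm{succ}(j)=\#\{i: i>_P j\}$. A poset is $(\mathbf{2}+\mathbf{2})$-free if it has no induced subposet isomorphic to the disjoint union of two $2$-element chains; unlabeled posets are isomorphism classes of posets. The $n$th Fishburn number $\mathfrak{f}_n$ is the coefficient of $t^n$ in $\sum_{m\ge0}\prod_{i=1}^{m}\bigl(1-(1-t)^i\bigr)$; it is known (Bousquet-Mélou, Claesson, Dukes, Kitaev) that $\mathfrak{f}_n$ equals the number of unlabeled $(\mathbf{2}+\mathbf{2})$-free posets on $n$ nodes, and also the number of matchings of $[2n]$ with no neighbor nestings (no pair of arcs $(i,\ell),(j,k)$ with $i<j<k<\ell$ and $j=i+1$ or $\ell=k+1$). *)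

theory Defs
  imports "HOL-Computational_Algebra.Computational_Algebra"
begin

text \<open>A poset on \<open>A\<close> is given by its strict order, a set of pairs \<open>(i, j)\<close> with \<open>i <\<^sub>P j\<close>.\<close>

definition strict_poset_on :: "'a set \<Rightarrow> 'a rel \<Rightarrow> bool" where
  "strict_poset_on A P \<longleftrightarrow> P \<subseteq> A \<times> A \<and> irrefl P \<and> trans P"

definition poset_isomorphic :: "'a set \<Rightarrow> 'a rel \<Rightarrow> 'b set \<Rightarrow> 'b rel \<Rightarrow> bool" where
  "poset_isomorphic A P B Q \<longleftrightarrow>
     (\<exists>f. bij_betw f A B \<and> (\<forall>x\<in>A. \<forall>y\<in>A. (x, y) \<in> P \<longleftrightarrow> (f x, f y) \<in> Q))"

text \<open>The disjoint union of two 2-element chains is represented by \<open>{1,2,3,4}\<close> with \<open>1 < 2\<close>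
  and \<open>3 < 4\<close>; \<open>Restr P B\<close> is the order induced on \<open>B\<close>.\<close>

definition two_plus_two_free :: "'a set \<Rightarrow> 'a rel \<Rightarrow> bool" where
  "two_plus_two_free A P \<longleftrightarrow>
     \<not> (\<exists>B\<subseteq>A. poset_isomorphic B (Restr P B) {1, 2, 3, 4 :: nat} {(1, 2), (3, 4)})"

definition naturally_labeled :: "nat rel \<Rightarrow> bool" where
  "naturally_labeled P \<longleftrightarrow> (\<forall>(i, j)\<in>P. i < j)"

definition factorial_poset :: "nat \<Rightarrow> nat rel \<Rightarrow> bool" where
  "factorial_poset n P \<longleftrightarrow> strict_poset_on {1..n} P \<and> naturally_labeled P \<and>
     (\<forall>i\<in>{1..n}. \<forall>j\<in>{1..n}. \<forall>k\<in>{1..n}. i < j \<and> (j, k) \<in> P \<longrightarrow> (i, k) \<in> P)"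

definition npred :: "'a rel \<Rightarrow> 'a \<Rightarrow> nat" where
  "npred P j = card {i. (i, j) \<in> P}"

definition nsucc :: "'a rel \<Rightarrow> 'a \<Rightarrow> nat" where
  "nsucc P j = card {i. (j, i) \<in> P}"

text \<open>Every poset with \<open>n\<close> elements is isomorphic to one on \<open>{1..n}\<close>, so it suffices to form
  isomorphism classes of posets on that set.\<close>

definition two_plus_two_free_posets :: "nat \<Rightarrow> nat rel set" where
  "two_plus_two_free_posets n = {P. strict_poset_on {1..n} P \<and> two_plus_two_free {1..n} P}"

definition unlabeled_two_plus_two_free_posets :: "nat \<Rightarrow> nat rel set set" where
  "unlabeled_two_plus_two_free_posets n = two_plus_two_free_posets n //
     {(P, Q). P \<in> two_plus_two_free_posets n \<and> Q \<in> two_plus_two_free_posets n \<and>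
              poset_isomorphic {1..n} P {1..n} Q}"

definition fishburn_factorial_posets :: "nat \<Rightarrow> nat rel set" where
  "fishburn_factorial_posets n = {P. factorial_poset n P \<and>
     (\<forall>i\<in>{1..n - 1}. npred P i \<le> npred P (i + 1) \<or> nsucc P i > nsucc P (i + 1))}"

text \<open>The infinite sum is taken in the metric topology of formal power series, where it converges
  by \<open>summable_fishburn\<close> below.\<close>

definition fishburn_fps :: "int fps" where
  "fishburn_fps = (\<Sum>m. \<Prod>i=1..m. (1 - (1 - fps_X) ^ i))"

definition fishburn :: "nat \<Rightarrow> int" where
  "fishburn n = fps_nth fishburn_fps n"

lemma poset_isomorphic_refl: "poset_isomorphic A P A P"
  unfolding poset_isomorphic_def by (intro exI[of _ id]) auto

lemma poset_isomorphic_sym: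
  assumes "poset_isomorphic A P B Q"
  shows "poset_isomorphic B Q A P"
proof -
  from assms obtain f where f: "bij_betw f A B"
    and iso: "\<forall>x\<in>A. \<forall>y\<in>A. (x, y) \<in> P \<longleftrightarrow> (f x, f y) \<in> Q"
    unfolding poset_isomorphic_def by blast
  have "bij_betw (inv_into A f) B A"
    using f by (rule bij_betw_inv_into)
  moreover have "(x, y) \<in> Q \<longleftrightarrow> (inv_into A f x, inv_into A f y) \<in> P"
    if "x \<in> B" "y \<in> B" for x y
  proof -
    have "inv_into A f x \<in> A" "inv_into A f y \<in> A"
      using that calculation by (auto dest: bij_betw_apply)
    moreover have "f (inv_into A f x) = x" "f (inv_into A f y) = y"
      using that f by (auto simp: bij_betw_inv_into_right)
    ultimately show ?thesis
      using iso by simp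
  qed
  ultimately show ?thesis
    unfolding poset_isomorphic_def by blast
qed

lemma poset_isomorphic_trans:
  assumes "poset_isomorphic A P B Q" "poset_isomorphic B Q C R"
  shows "poset_isomorphic A P C R"
proof -
  from assms(1) obtain f where f: "bij_betw f A B"
    and PQ: "\<forall>x\<in>A. \<forall>y\<in>A. (x, y) \<in> P \<longleftrightarrow> (f x, f y) \<in> Q"
    unfolding poset_isomorphic_def by blast
  from assms(2) obtain g where g: "bij_betw g B C"
    and QR: "\<forall>x\<in>B. \<forall>y\<in>B. (x, y) \<in> Q \<longleftrightarrow> (g x, g y) \<in> R"
    unfolding poset_isomorphic_def by blast
  have "bij_betw (g \<circ> f) A C"
    using f g by (rule bij_betw_trans)
  moreover have "\<forall>x\<in>A. \<forall>y\<in>A. (x, y) \<in> P \<longleftrightarrow> ((g \<circ> f) x, (g \<circ> f) y) \<in> R"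
    using PQ QR bij_betw_apply[OF f] by simp
  ultimately show ?thesis
    unfolding poset_isomorphic_def by blast
qed

lemma equiv_poset_isomorphic:
  "equiv (two_plus_two_free_posets n)
     {(P, Q). P \<in> two_plus_two_free_posets n \<and> Q \<in> two_plus_two_free_posets n \<and>
              poset_isomorphic {1..n} P {1..n} Q}"
proof (rule equivI)
qed (use poset_isomorphic_refl poset_isomorphic_sym poset_isomorphic_trans in
      \<open>(fastforce simp: refl_on_def sym_def trans_def)+\<close>)

lemma fishburn_summand_nth_eq_0:
  assumes "k < m"
  shows "fps_nth (\<Prod>i=1..m. (1 - (1 - fps_X) ^ i) :: int fps) k = 0"
proof -
  have "fps_X dvd (1 - (1 - fps_X) ^ i :: int fps)" for i
  proof (induction i)
    case (Suc i)
    have "1 - (1 - fps_X) ^ Suc i =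
        (1 - (1 - fps_X) ^ i) + fps_X * (1 - fps_X :: int fps) ^ i"
      by (simp add: algebra_simps)
    then show ?case
      using Suc by (metis dvd_add dvd_triv_left)
  qed simp
  then have "(\<Prod>i=1..m. fps_X) dvd (\<Prod>i=1..m. (1 - (1 - fps_X) ^ i) :: int fps)"
    by (intro prod_dvd_prod) auto
  then have "fps_X ^ m dvd (\<Prod>i=1..m. (1 - (1 - fps_X) ^ i) :: int fps)"
    by simp
  then obtain h where "(\<Prod>i=1..m. (1 - (1 - fps_X) ^ i) :: int fps) = fps_X ^ m * h"
    by (auto elim: dvdE)
  then show ?thesis
    using assms by (simp add: fps_X_power_mult_nth)
qed

lemma summable_fishburn:
  "summable (\<lambda>m. \<Prod>i=1..m. (1 - (1 - fps_X) ^ i) :: int fps)"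
proof -
  define g :: "nat \<Rightarrow> int fps" where "g = (\<lambda>m. \<Prod>i=1..m. (1 - (1 - fps_X) ^ i))"
  have g0: "fps_nth (g m) k = 0" if "k < m" for k m
    unfolding g_def using that by (rule fishburn_summand_nth_eq_0)
  define s where "s = Abs_fps (\<lambda>k. \<Sum>m\<le>k. fps_nth (g m) k)"
  have nth: "fps_nth (\<Sum>m<N. g m) k = fps_nth s k" if "k < N" for k N
  proof -
    have "fps_nth (\<Sum>m<N. g m) k = (\<Sum>m<N. fps_nth (g m) k)"
      by (simp add: fps_sum_nth)
    also have "\<dots> = (\<Sum>m\<le>k. fps_nth (g m) k)"
      using that g0 by (intro sum.mono_neutral_right) auto
    finally show ?thesis by (simp add: s_def)
  qed
  have "dist (\<Sum>m<N. g m) s \<le> (1 / 2) ^ N" for N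
  proof (cases "(\<Sum>m<N. g m) = s")
    case False
    then have "N \<le> subdegree ((\<Sum>m<N. g m) - s)"
      using nth by (intro subdegree_geI) auto
    then have "(1 / 2 :: real) ^ subdegree ((\<Sum>m<N. g m) - s) \<le> (1 / 2) ^ N"
      by (intro power_decreasing) auto
    then show ?thesis
      using False by (simp add: dist_fps_def power_one_over inverse_eq_divide)
  qed simp
  then have "(\<lambda>N. dist (\<Sum>m<N. g m) s) \<longlonglongrightarrow> 0"
    by (intro tendsto_sandwich[OF _ _ tendsto_const LIMSEQ_power_zero[of "1 / 2 :: real"]]
          always_eventually allI) simp_all
  then have "g sums s"
    unfolding sums_def using tendsto_dist_iff by blast
  then show ?thesis
    by (auto simp: g_def summable_def)
qed

end

theory Submission
  imports Defs "HOL-Library.Product_Lexorder"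
begin

text \<open>
  In a factorial poset the predecessors of \<open>j\<close> form an initial segment of the labels, so the order
  is determined by the numbers \<open>pred j < j\<close>, which may be chosen freely. Two observations
  give the theorem.

  First, a finite poset is \<open>(2+2)\<close>-free exactly when its sets of predecessors, and equally its sets
  of successors, form chains under inclusion. Sort the elements of such a poset by decreasing number
  of successors and, among elements with equally many successors, by increasing number of
  predecessors. Elements that tie in both respects have the same successors and the same
  predecessors, hence are interchangeable; so every isomorphism class contains exactly one poset
  labeled in this order. Being labeled in this order is precisely being factorial
  with the local condition of the theorem (\<open>fishburn_factorial_posets_eq\<close>): the successor numbers
  of a factorial poset decrease weakly on their own, and the local condition orders the ties.

  Second, \<open>succ i > succ (i + 1)\<close> holds in a factorial poset iff \<open>i\<close> is the value \<open>pred k\<close> for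
  some \<open>k\<close>. So the posets to be counted are the sequences \<open>pred 1, \<dots>, pred n\<close> with \<open>pred j < j\<close>
  in which no \<open>i\<close> is at the same time a descent, \<open>pred i > pred (i + 1)\<close>, and missing among the
  values. By inclusion and exclusion their number is the sum over all \<open>S \<subseteq> {1..n-1}\<close>, with sign
  \<open>(-1)\<close> to the power \<open>card S\<close>, of the number of sequences for which every \<open>i \<in> S\<close> is such a
  missing descent. Cut the sequence after each position outside \<open>S\<close>. Inside a block the
  sequence is strictly decreasing, so the bound \<open>pred j < j\<close> matters only at the beginning of
  the block. The values available to the \<open>j\<close>-th block are therefore \<open>0\<close> and the
  final positions of the earlier blocks, \<open>j\<close> values in all, and a block of length \<open>s\<close> can be filled in
  \<open>j choose s\<close> ways (\<open>card_tables_missing_Un\<close>). With its sign, the \<open>j\<close>-th block contributes the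
  generating function
  \<open>\<Sum>s\<ge>1. (-1)^(s-1) * (j choose s) * t^s = 1 - (1 - t)^j\<close>, and summing over the number of
  blocks gives the Fishburn series (\<open>signed_count_eq\<close>).
\<close>

section \<open>Posets without an induced 2+2\<close>

lemma strict_poset_onD:
  assumes "strict_poset_on A P"
  shows "P \<subseteq> A \<times> A" "(x, x) \<notin> P" "(x, y) \<in> P \<Longrightarrow> (y, z) \<in> P \<Longrightarrow> (x, z) \<in> P"
proof -
  show "P \<subseteq> A \<times> A" "(x, x) \<notin> P"
    using assms by (auto simp: strict_poset_on_def irrefl_def)
  have "trans P"
    using assms by (simp add: strict_poset_on_def)
  then show "(x, y) \<in> P \<Longrightarrow> (y, z) \<in> P \<Longrightarrow> (x, z) \<in> P"
    by (rule transD)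
qed

text \<open>
  The right-hand side says that any two sets of predecessors, and any two sets of successors, are
  comparable under inclusion. A violation \<open>a < b\<close>, \<open>c < d\<close> has \<open>a, b, c, d\<close> distinct and no
  further relations among them, since by transitivity each of these would yield \<open>a < d\<close>,
  \<open>c < b\<close> or an element below itself.
\<close>
lemma two_plus_two_free_iff:
  assumes "strict_poset_on A P"
  shows "two_plus_two_free A P \<longleftrightarrow>
    (\<forall>a b c d. (a, b) \<in> P \<longrightarrow> (c, d) \<in> P \<longrightarrow> (a, d) \<in> P \<or> (c, b) \<in> P)"
proof (intro iffI allI impI; (rule ccontr)?)
  fix a b c d
  assume free: "two_plus_two_free A P" and ab: "(a, b) \<in> P" and cd: "(c, d) \<in> P"
    and neg: "\<not> ((a, d) \<in> P \<or> (c, b) \<in> P)"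
  note P = strict_poset_onD[OF assms]
  have ne: "a \<noteq> b" "a \<noteq> c" "a \<noteq> d" "b \<noteq> c" "b \<noteq> d" "c \<noteq> d"
    using ab cd neg P(2) P(3) by metis+
  have np: "(a, c) \<notin> P" "(c, a) \<notin> P" "(b, d) \<notin> P" "(d, b) \<notin> P" "(b, c) \<notin> P" "(d, a) \<notin> P"
    "(b, a) \<notin> P" "(d, c) \<notin> P"
    using ab cd neg P(2) P(3) by metis+
  define g :: "'a \<Rightarrow> nat" where
    "g = (\<lambda>x. if x = a then 1 else if x = b then 2 else if x = c then 3 else 4)"
  have "bij_betw g {a, b, c, d} {1, 2, 3, 4}"
    using ne by (auto simp: bij_betw_def inj_on_def g_def)
  moreover have "\<forall>x\<in>{a, b, c, d}. \<forall>y\<in>{a, b, c, d}.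
      (x, y) \<in> Restr P {a, b, c, d} \<longleftrightarrow> (g x, g y) \<in> {(1, 2), (3, 4)}"
    using ne np ab cd neg P(2) by (auto simp: g_def)
  ultimately have "poset_isomorphic {a, b, c, d} (Restr P {a, b, c, d})
      {1, 2, 3, 4 :: nat} {(1, 2), (3, 4)}"
    unfolding poset_isomorphic_def by blast
  moreover have "{a, b, c, d} \<subseteq> A"
    using ab cd P(1) by auto
  ultimately show False
    using free unfolding two_plus_two_free_def by blast
next
  assume cond: "\<forall>a b c d. (a, b) \<in> P \<longrightarrow> (c, d) \<in> P \<longrightarrow> (a, d) \<in> P \<or> (c, b) \<in> P"
    and "\<not> two_plus_two_free A P"
  then obtain B where "poset_isomorphic B (Restr P B) {1, 2, 3, 4 :: nat} {(1, 2), (3, 4)}"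
    unfolding two_plus_two_free_def by blast
  from poset_isomorphic_sym[OF this] obtain h where
    h: "bij_betw h {1, 2, 3, 4 :: nat} B" and iso: "\<forall>x\<in>{1, 2, 3, 4}. \<forall>y\<in>{1, 2, 3, 4}.
      (x, y) \<in> {(1, 2), (3, 4)} \<longleftrightarrow> (h x, h y) \<in> Restr P B"
    unfolding poset_isomorphic_def by blast
  have "h 1 \<in> B" "h 2 \<in> B" "h 3 \<in> B" "h 4 \<in> B"
    using h by (auto simp: bij_betw_def)
  then have "(h 1, h 2) \<in> P" "(h 3, h 4) \<in> P" "(h 1, h 4) \<notin> P" "(h 3, h 2) \<notin> P"
    using iso by auto
  with cond show False by blast
qed

lemma npred_isomorphism:
  assumes f: "bij_betw f A B" and sub: "P \<subseteq> A \<times> A" "Q \<subseteq> B \<times> B"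
    and iso: "\<And>x y. x \<in> A \<Longrightarrow> y \<in> A \<Longrightarrow> (f x, f y) \<in> Q \<longleftrightarrow> (x, y) \<in> P"
    and x: "x \<in> A"
  shows "npred Q (f x) = npred P x"
proof -
  have "bij_betw f {i. (i, x) \<in> P} {i. (i, f x) \<in> Q}"
  proof (rule bij_betw_imageI)
    show "inj_on f {i. (i, x) \<in> P}"
      using bij_betw_imp_inj_on[OF f] by (rule inj_on_subset) (use sub in auto)
    show "f ` {i. (i, x) \<in> P} = {i. (i, f x) \<in> Q}"
    proof (intro subset_antisym subsetI)
      fix j assume j: "j \<in> {i. (i, f x) \<in> Q}"
      then obtain i where "i \<in> A" "j = f i"
        using sub bij_betw_imp_surj_on[OF f] by auto
      with j iso x show "j \<in> f ` {i. (i, x) \<in> P}" by auto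
    qed (use sub iso x in auto)
  qed
  then show ?thesis by (simp add: npred_def bij_betw_same_card)
qed

text \<open>Reversing both orders turns successors into predecessors.\<close>
lemma nsucc_isomorphism:
  assumes "bij_betw f A B" "P \<subseteq> A \<times> A" "Q \<subseteq> B \<times> B"
    and "\<And>x y. x \<in> A \<Longrightarrow> y \<in> A \<Longrightarrow> (f x, f y) \<in> Q \<longleftrightarrow> (x, y) \<in> P"
    and "x \<in> A"
  shows "nsucc Q (f x) = nsucc P x"
proof -
  have "npred (Q\<inverse>) (f x) = npred (P\<inverse>) x"
    by (rule npred_isomorphism[of f A B]) (use assms in auto)
  then show ?thesis by (simp add: npred_def nsucc_def)
qed

section \<open>Canonical labelings\<close>

text \<open>
  Pairs are compared lexicographically. Successors are subtracted from \<open>n\<close>, which bounds them, so that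
  more successors mean a smaller key.
\<close>
definition label_key :: "nat \<Rightarrow> nat rel \<Rightarrow> nat \<Rightarrow> nat \<times> nat" where
  "label_key n P i = (n - nsucc P i, npred P i)"

definition canonically_labeled :: "nat \<Rightarrow> nat rel \<Rightarrow> bool" where
  "canonically_labeled n P \<longleftrightarrow> sorted (map (label_key n P) [1..<Suc n])"

lemma canonically_labeled_iff_Suc:
  "canonically_labeled n P \<longleftrightarrow>
     (\<forall>i\<in>{1..n - 1}. label_key n P i \<le> label_key n P (Suc i))"
proof -
  have "canonically_labeled n P \<longleftrightarrow>
     (\<forall>i. Suc i < n \<longrightarrow> label_key n P (Suc i) \<le> label_key n P (Suc (Suc i)))"
    unfolding canonically_labeled_def
    by (subst sorted_wrt_iff_nth_Suc_transp) (auto simp: transp_on_def simp del: upt_Suc)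
  also have "\<dots> \<longleftrightarrow> (\<forall>i\<in>{1..n - 1}. label_key n P i \<le> label_key n P (Suc i))"
  proof safe
    fix i assume "\<forall>i. Suc i < n \<longrightarrow> label_key n P (Suc i) \<le> label_key n P (Suc (Suc i))"
      "i \<in> {1..n - 1}"
    then show "label_key n P i \<le> label_key n P (Suc i)"
      by (cases i) auto
  qed auto
  finally show ?thesis .
qed

lemma canonically_labeledD:
  assumes "canonically_labeled n P" "1 \<le> i" "i \<le> j" "j \<le> n"
  shows "label_key n P i \<le> label_key n P j"
proof -
  have "map (label_key n P) [1..<Suc n] ! (i - 1) \<le> map (label_key n P) [1..<Suc n] ! (j - 1)"
    using assms unfolding canonically_labeled_def by (intro sorted_nth_mono) auto
  then show ?thesis using assms by (simp del: upt_Suc)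
qed

lemma nsucc_le:
  assumes "P \<subseteq> {1..n} \<times> {1..n}"
  shows "nsucc P i \<le> n"
proof -
  have "nsucc P i \<le> card {1..n}"
    unfolding nsucc_def using assms by (intro card_mono) auto
  then show ?thesis by simp
qed

section \<open>Factorial posets as canonically labeled posets\<close>

lemma factorial_posetD:
  assumes "factorial_poset n P"
  shows "strict_poset_on {1..n} P" "P \<subseteq> {1..n} \<times> {1..n}" "(i, j) \<in> P \<Longrightarrow> i < j"
    "(j, k) \<in> P \<Longrightarrow> 1 \<le> i \<Longrightarrow> i \<le> j \<Longrightarrow> (i, k) \<in> P"
proof -
  show 1: "strict_poset_on {1..n} P" and 3: "(i, j) \<in> P \<Longrightarrow> i < j"
    using assms unfolding factorial_poset_def naturally_labeled_def by auto
  show 2: "P \<subseteq> {1..n} \<times> {1..n}"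
    using 1 by (rule strict_poset_onD)
  show "(i, k) \<in> P" if "(j, k) \<in> P" "1 \<le> i" "i \<le> j"
  proof (cases "i = j")
    case False
    have "i \<in> {1..n}" "j \<in> {1..n}" "k \<in> {1..n}" "i < j"
      using that 2 False by auto
    then show ?thesis
      using assms that(1) unfolding factorial_poset_def by blast
  qed (use that in simp)
qed

lemma factorial_poset_pred:
  assumes "factorial_poset n P"
  shows "{i. (i, j) \<in> P} = {1..npred P j}"
proof -
  note P = factorial_posetD[OF assms]
  let ?S = "{i. (i, j) \<in> P}"
  have fin: "finite ?S"
    by (rule finite_subset[of _ "{1..n}"]) (use P(2) in auto)
  show ?thesis
  proof (cases "?S = {}")
    case False
    have "Max ?S \<in> ?S" using fin False by (rule Max_in)
    have "?S = {1..Max ?S}"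
    proof (intro subset_antisym subsetI)
      fix i assume "i \<in> ?S"
      then show "i \<in> {1..Max ?S}" using fin P(2) by auto
    next
      fix i assume "i \<in> {1..Max ?S}"
      then show "i \<in> ?S" using P(4)[of "Max ?S" j i] \<open>Max ?S \<in> ?S\<close> by auto
    qed
    then show ?thesis
      unfolding npred_def by (metis card_atLeastAtMost diff_Suc_1)
  qed (simp add: npred_def)
qed

lemma factorial_poset_eqI:
  assumes "factorial_poset n P" "factorial_poset n Q"
    and eq: "\<And>j. j \<in> {1..n} \<Longrightarrow> npred P j = npred Q j"
  shows "P = Q"
proof -
  have "(i, j) \<in> P \<longleftrightarrow> (i, j) \<in> Q" for i j
  proof (cases "j \<in> {1..n}")
    case True
    then show ?thesis
      using factorial_poset_pred[OF assms(1), of j] factorial_poset_pred[OF assms(2), of j] eq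
      by auto
  next
    case False
    then show ?thesis using factorial_posetD(2)[OF assms(1)] factorial_posetD(2)[OF assms(2)]
      by auto
  qed
  then show ?thesis by auto
qed

lemma factorial_poset_npred_less:
  assumes "factorial_poset n P" "1 \<le> j"
  shows "npred P j < j"
proof (cases "npred P j = 0")
  case False
  then have "npred P j \<in> {i. (i, j) \<in> P}"
    unfolding factorial_poset_pred[OF assms(1)] by simp
  then show ?thesis using factorial_posetD(3)[OF assms(1)] by simp
qed (use assms in simp)

lemma factorial_poset_succ_antimono:
  assumes "factorial_poset n P" "1 \<le> i" "i \<le> j"
  shows "{k. (j, k) \<in> P} \<subseteq> {k. (i, k) \<in> P}"
  using factorial_posetD(4)[OF assms(1) _ assms(2,3)] by auto

lemma finite_succ:
  assumes "P \<subseteq> {1..n::nat} \<times> {1..n}"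
  shows "finite {k. (j, k) \<in> P}"
  by (rule finite_subset[of _ "{1..n}"]) (use assms in auto)

text \<open>Initial segments of the labels form a chain, and so do the sets of predecessors.\<close>
lemma factorial_poset_two_plus_two_free:
  assumes "factorial_poset n P"
  shows "two_plus_two_free {1..n} P"
proof -
  note P = factorial_posetD[OF assms]
  have "(a, d) \<in> P \<or> (c, b) \<in> P" if "(a, b) \<in> P" "(c, d) \<in> P" for a b c d
    using that P(2) P(4)[of a b c] P(4)[of c d a] by (cases "a \<le> c") auto
  then show ?thesis unfolding two_plus_two_free_iff[OF P(1)] by blast
qed

text \<open>
  The sets of successors form a chain, so they are ordered by inclusion as their cardinalities are;
  hence they shrink weakly along the labels, which is the factorial condition. If \<open>i < j\<close> in the poset,
  then the successors of \<open>i\<close> strictly include those of \<open>j\<close>, which makes the labeling natural.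
\<close>
lemma canonically_labeled_imp_factorial:
  assumes P: "P \<in> two_plus_two_free_posets n" and can: "canonically_labeled n P"
  shows "factorial_poset n P"
proof -
  have sp: "strict_poset_on {1..n} P"
    and free: "\<And>a b c d. (a, b) \<in> P \<Longrightarrow> (c, d) \<in> P \<Longrightarrow> (a, d) \<in> P \<or> (c, b) \<in> P"
    using P two_plus_two_free_iff[of "{1..n}" P] unfolding two_plus_two_free_posets_def by blast+
  note P = strict_poset_onD[OF sp]
  have succ_le: "nsucc P j \<le> nsucc P i" if "1 \<le> i" "i \<le> j" "j \<le> n" for i j
    using canonically_labeledD[OF can that] nsucc_le[OF P(1), of i] nsucc_le[OF P(1), of j]
    by (auto simp: label_key_def)
  have lt: "i < j" if "(i, j) \<in> P" for i j
  proof (rule ccontr)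
    assume "\<not> i < j"
    then have "nsucc P i \<le> nsucc P j"
      using succ_le[of j i] that P(1) by auto
    moreover have "{k. (j, k) \<in> P} \<subset> {k. (i, k) \<in> P}"
      using P(2,3) that by blast
    then have "nsucc P j < nsucc P i"
      unfolding nsucc_def by (intro psubset_card_mono finite_succ[OF P(1)])
    ultimately show False by simp
  qed
  have "(i, k) \<in> P" if "i \<in> {1..n}" "j \<in> {1..n}" "i < j" "(j, k) \<in> P" for i j k
  proof (rule ccontr)
    assume neg: "(i, k) \<notin> P"
    have "{l. (i, l) \<in> P} \<subset> {l. (j, l) \<in> P}"
      using free[OF _ that(4)] neg that(4) by blast
    then have "nsucc P i < nsucc P j"
      unfolding nsucc_def by (intro psubset_card_mono finite_succ[OF P(1)])
    then show False using succ_le[of i j] that by auto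
  qed
  then show ?thesis
    using sp lt unfolding factorial_poset_def naturally_labeled_def by auto
qed

text \<open>
  Consecutive keys are in order iff \<open>nsucc\<close> drops or, at equal \<open>nsucc\<close>, \<open>npred\<close> does not. Since
  \<open>nsucc\<close> never increases along the labels of a factorial poset, this is the local condition.
\<close>
lemma fishburn_factorial_posets_eq:
  "fishburn_factorial_posets n = {P \<in> two_plus_two_free_posets n. canonically_labeled n P}"
proof -
  have "(\<forall>i\<in>{1..n - 1}. npred P i \<le> npred P (i + 1) \<or> nsucc P i > nsucc P (i + 1)) \<longleftrightarrow>
      canonically_labeled n P" if fac: "factorial_poset n P" for P
    unfolding canonically_labeled_iff_Suc
  proof (intro ball_cong refl)
    fix i assume i: "i \<in> {1..n - 1}"
    note sub = factorial_posetD(2)[OF fac]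
    have "nsucc P (Suc i) \<le> nsucc P i"
      unfolding nsucc_def using i
      by (intro card_mono finite_succ[OF sub] factorial_poset_succ_antimono[OF fac]) auto
    then show "(npred P i \<le> npred P (i + 1) \<or> nsucc P i > nsucc P (i + 1)) \<longleftrightarrow>
      label_key n P i \<le> label_key n P (Suc i)"
      using nsucc_le[OF sub, of i] by (auto simp: label_key_def)
  qed
  moreover have "factorial_poset n P \<Longrightarrow> P \<in> two_plus_two_free_posets n" for P
    using factorial_poset_two_plus_two_free factorial_posetD(1)
    unfolding two_plus_two_free_posets_def by blast
  ultimately show ?thesis
    unfolding fishburn_factorial_posets_def using canonically_labeled_imp_factorial by blast
qed

text \<open>
  An isomorphism preserves the multiset of keys. Both posets list this multiset in sorted order, so
  they agree in every key, in particular in every \<open>npred\<close>, and these numbers determine the poset.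
\<close>
lemma isomorphic_fishburn_factorial_posets_eq:
  assumes "P \<in> fishburn_factorial_posets n" "Q \<in> fishburn_factorial_posets n"
    and iso: "poset_isomorphic {1..n} P {1..n} Q"
  shows "P = Q"
proof -
  have facP: "factorial_poset n P" and facQ: "factorial_poset n Q"
    using assms(1,2) by (auto simp: fishburn_factorial_posets_def)
  have can: "canonically_labeled n P" "canonically_labeled n Q"
    using assms(1,2) by (auto simp: fishburn_factorial_posets_eq)
  note sub = factorial_posetD(2)[OF facP] factorial_posetD(2)[OF facQ]
  obtain f where f: "bij_betw f {1..n} {1..n}"
    and "\<And>i j. i \<in> {1..n} \<Longrightarrow> j \<in> {1..n} \<Longrightarrow> (f i, f j) \<in> Q \<longleftrightarrow> (i, j) \<in> P"
    using iso unfolding poset_isomorphic_def by blast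
  then have key: "label_key n Q (f i) = label_key n P i" if "i \<in> {1..n}" for i
    using npred_isomorphism[OF f sub _ that] nsucc_isomorphism[OF f sub _ that]
    by (simp add: label_key_def)
  have ms: "mset [1..<Suc n] = mset_set {1..n}"
    by (metis atLeastLessThanSuc_atLeastAtMost mset_upt)
  have "image_mset (label_key n Q) (mset_set {1..n}) =
      image_mset (label_key n Q) (image_mset f (mset_set {1..n}))"
    using f by (simp add: image_mset_mset_set bij_betw_def)
  also have "\<dots> = image_mset (label_key n P) (mset_set {1..n})"
    unfolding image_mset.compositionality by (rule image_mset_cong) (auto simp: key)
  finally have "mset (map (label_key n Q) [1..<Suc n]) = mset (map (label_key n P) [1..<Suc n])"
    by (simp only: mset_map ms)
  then have "map (label_key n P) [1..<Suc n] = map (label_key n Q) [1..<Suc n]"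
    using can unfolding canonically_labeled_def by (metis properties_for_sort sorted_sort_id)
  then have "npred P j = npred Q j" if "j \<in> {1..n}" for j
    using that by (auto simp: label_key_def simp del: upt_Suc)
  with facP facQ show ?thesis by (rule factorial_poset_eqI)
qed

lemma ex_canonical_labeling:
  assumes P: "P \<in> two_plus_two_free_posets n"
  shows "\<exists>Q\<in>fishburn_factorial_posets n. poset_isomorphic {1..n} P {1..n} Q"
proof -
  have sp: "strict_poset_on {1..n} P"
    and free: "\<And>a b c d. (a, b) \<in> P \<Longrightarrow> (c, d) \<in> P \<Longrightarrow> (a, d) \<in> P \<or> (c, b) \<in> P"
    using P two_plus_two_free_iff[of "{1..n}" P] unfolding two_plus_two_free_posets_def by blast+
  note P' = strict_poset_onD[OF sp]
  define xs where "xs = sort_key (label_key n P) [1..<Suc n]"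
  have xs: "length xs = n" "distinct xs" "set xs = {1..n}" "sorted (map (label_key n P) xs)"
    by (auto simp: xs_def)
  define g where "g = (\<lambda>i. xs ! (i - 1))"
  have "bij_betw (\<lambda>i. i - 1) {1..n} {..<n}"
    by (rule bij_betw_byWitness[of _ Suc]) auto
  then have "bij_betw ((!) xs \<circ> (\<lambda>i. i - 1)) {1..n} {1..n}"
    by (rule bij_betw_trans) (use xs in \<open>auto intro!: bij_betw_nth\<close>)
  then have g: "bij_betw g {1..n} {1..n}"
    by (simp add: g_def comp_def)
  define Q where "Q = {(i, j). i \<in> {1..n} \<and> j \<in> {1..n} \<and> (g i, g j) \<in> P}"
  have Q: "strict_poset_on {1..n} Q"
    using P'(2,3) unfolding strict_poset_on_def irrefl_def trans_def Q_def by blast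
  have "two_plus_two_free {1..n} Q"
    unfolding two_plus_two_free_iff[OF Q] using free by (auto simp: Q_def)
  with Q have QT: "Q \<in> two_plus_two_free_posets n"
    by (simp add: two_plus_two_free_posets_def)
  have iso: "poset_isomorphic {1..n} Q {1..n} P"
    unfolding poset_isomorphic_def using g by (auto simp: Q_def intro!: exI[of _ g])
  have key: "label_key n Q i = label_key n P (g i)" if "i \<in> {1..n}" for i
  proof -
    have sub: "Q \<subseteq> {1..n} \<times> {1..n}"
      and "\<And>i j. i \<in> {1..n} \<Longrightarrow> j \<in> {1..n} \<Longrightarrow> (g i, g j) \<in> P \<longleftrightarrow> (i, j) \<in> Q"
      by (auto simp: Q_def)
    then show ?thesis
      using npred_isomorphism[OF g sub P'(1) _ that] nsucc_isomorphism[OF g sub P'(1) _ that]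
      by (simp add: label_key_def)
  qed
  have "map (label_key n Q) [1..<Suc n] = map (label_key n P) xs"
    by (rule nth_equalityI) (auto simp: xs(1) key g_def simp del: upt_Suc)
  then have "canonically_labeled n Q"
    using xs(4) by (simp add: canonically_labeled_def del: upt_Suc)
  with QT iso show ?thesis
    unfolding fishburn_factorial_posets_eq using poset_isomorphic_sym by blast
qed

text \<open>The bijection sends a poset to its isomorphism class.\<close>
theorem fishburn_factorial_posets_bij_unlabeled:
  "\<exists>\<phi>. bij_betw \<phi> (fishburn_factorial_posets n) (unlabeled_two_plus_two_free_posets n)"
proof -
  define T where "T = two_plus_two_free_posets n"
  define E where "E = {(P, Q). P \<in> T \<and> Q \<in> T \<and> poset_isomorphic {1..n} P {1..n} Q}"
  have eqv: "equiv T E"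
    unfolding T_def E_def by (rule equiv_poset_isomorphic)
  have sub: "fishburn_factorial_posets n \<subseteq> T"
    by (auto simp: T_def fishburn_factorial_posets_eq)
  have "bij_betw (\<lambda>P. E `` {P}) (fishburn_factorial_posets n) (T // E)"
  proof (rule bij_betwI')
    fix P Q assume "P \<in> fishburn_factorial_posets n" "Q \<in> fishburn_factorial_posets n"
    then show "(E `` {P} = E `` {Q}) = (P = Q)"
      using eq_equiv_class_iff[OF eqv, of P Q] sub isomorphic_fishburn_factorial_posets_eq[of P n Q]
      by (auto simp: E_def)
  next
    fix P assume "P \<in> fishburn_factorial_posets n"
    then show "E `` {P} \<in> T // E" using sub by (auto intro: quotientI)
  next
    fix C assume "C \<in> T // E"
    then obtain P where P: "P \<in> T" "C = E `` {P}" by (auto elim: quotientE)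
    obtain Q where Q: "Q \<in> fishburn_factorial_posets n" "poset_isomorphic {1..n} P {1..n} Q"
      using ex_canonical_labeling P(1) by (auto simp: T_def)
    then have "(P, Q) \<in> E" using P(1) sub by (auto simp: E_def)
    then have "C = E `` {Q}" unfolding P(2) using eqv by (simp add: equiv_class_eq)
    with Q show "\<exists>Q\<in>fishburn_factorial_posets n. C = E `` {Q}" by blast
  qed
  then show ?thesis
    unfolding unlabeled_two_plus_two_free_posets_def T_def E_def by blast
qed

section \<open>Encoding by inversion tables\<close>

definition inversion_tables :: "nat \<Rightarrow> nat list set" where
  "inversion_tables n = {xs. length xs = n \<and> (\<forall>i<n. xs ! i \<le> i)}"

text \<open>
  Lists are indexed from \<open>0\<close> and labels from \<open>1\<close>: the entry \<open>xs ! i\<close> encodes the number of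
  predecessors of \<open>i + 1\<close>. A descent from label \<open>i\<close> to label \<open>i + 1\<close> is thus a descent from
  \<open>xs ! (i - 1)\<close> to \<open>xs ! i\<close>.
\<close>
definition missing_descents :: "nat list \<Rightarrow> nat set" where
  "missing_descents xs = {i \<in> {1..<length xs}. xs ! i < xs ! (i - 1) \<and> i \<notin> set xs}"

lemma finite_inversion_tables: "finite (inversion_tables n)"
proof (rule finite_subset)
  show "inversion_tables n \<subseteq> {xs. set xs \<subseteq> {..n} \<and> length xs = n}"
  proof (intro subsetI CollectI conjI)
    fix xs x assume xs: "xs \<in> inversion_tables n"
    then show "length xs = n" by (simp add: inversion_tables_def)
    assume "x \<in> set xs"
    then obtain i where "i < n" "x = xs ! i"
      using \<open>length xs = n\<close> by (auto simp: in_set_conv_nth)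
    then show "x \<in> {..n}"
      using xs by (fastforce simp: inversion_tables_def)
  qed
qed (simp add: finite_lists_length_eq)

text \<open>
  Since \<open>(i, j) \<in> P\<close> means \<open>1 \<le> i \<le> npred P j\<close>, the elements above \<open>i\<close> but not above \<open>i + 1\<close> are
  the \<open>j\<close> with \<open>npred P j = i\<close>.
\<close>
lemma nsucc_gt_Suc_iff:
  assumes fac: "factorial_poset n P" and i: "i \<in> {1..n - 1}"
  shows "nsucc P i > nsucc P (i + 1) \<longleftrightarrow> i \<in> npred P ` {1..n}"
proof -
  note P = factorial_posetD[OF fac]
  have rel: "(k, j) \<in> P \<longleftrightarrow> k \<in> {1..npred P j}" for k j
    using factorial_poset_pred[OF fac, of j] by blast
  have sub: "{k. (i + 1, k) \<in> P} \<subseteq> {k. (i, k) \<in> P}"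
    using i by (intro factorial_poset_succ_antimono[OF fac]) auto
  have "nsucc P i > nsucc P (i + 1) \<longleftrightarrow> {k. (i + 1, k) \<in> P} \<subset> {k. (i, k) \<in> P}"
    unfolding nsucc_def using sub finite_succ[OF P(2)]
    by (metis (no_types, lifting) less_irrefl psubsetI psubset_card_mono)
  also have "\<dots> \<longleftrightarrow> (\<exists>j. i \<le> npred P j \<and> \<not> i + 1 \<le> npred P j)"
    using sub i by (auto simp: rel psubset_eq)
  also have "\<dots> \<longleftrightarrow> (\<exists>j. npred P j = i)"
    by (metis Suc_eq_plus1 le_antisym le_refl not_less_eq_eq)
  also have "\<dots> \<longleftrightarrow> i \<in> npred P ` {1..n}"
  proof -
    have "j \<in> {1..n}" if "npred P j = i" for j
      using that i rel[of i j] P(2) by auto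
    then show ?thesis by auto
  qed
  finally show ?thesis .
qed

lemma bij_betw_fishburn_inversion_tables:
  "bij_betw (\<lambda>P. map (npred P) [1..<Suc n]) (fishburn_factorial_posets n)
     {xs \<in> inversion_tables n. missing_descents xs = {}}"
proof (rule bij_betwI')
  fix P Q assume "P \<in> fishburn_factorial_posets n" "Q \<in> fishburn_factorial_posets n"
  then have "factorial_poset n P" "factorial_poset n Q"
    by (auto simp: fishburn_factorial_posets_def)
  then show "(map (npred P) [1..<Suc n] = map (npred Q) [1..<Suc n]) \<longleftrightarrow> P = Q"
    using factorial_poset_eqI[of n P Q] by (auto simp del: upt_Suc)
next
  fix P assume P: "P \<in> fishburn_factorial_posets n"
  then have fac: "factorial_poset n P"
    by (auto simp: fishburn_factorial_posets_def)
  let ?xs = "map (npred P) [1..<Suc n]"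
  have nth: "?xs ! j = npred P (Suc j)" if "j < n" for j
    using that by (simp del: upt_Suc)
  have len: "length ?xs = n" by simp
  have set: "set ?xs = npred P ` {1..n}"
    by (simp add: atLeastLessThanSuc_atLeastAtMost del: upt_Suc)
  have "?xs \<in> inversion_tables n"
    using factorial_poset_npred_less[OF fac] unfolding inversion_tables_def
    by (auto simp: nth less_Suc_eq_le[symmetric] simp del: upt_Suc)
  moreover have "i \<notin> missing_descents ?xs" for i
  proof
    assume i: "i \<in> missing_descents ?xs"
    then have i': "i \<in> {1..n - 1}" "i < n" "1 \<le> i"
      unfolding missing_descents_def len by auto
    then have "\<not> npred P i \<le> npred P (i + 1)" "i \<notin> npred P ` {1..n}"
      using i nth[of i] nth[of "i - 1"] unfolding missing_descents_def set by auto
    then show False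
      using P nsucc_gt_Suc_iff[OF fac i'(1)] i'(1) unfolding fishburn_factorial_posets_def by auto
  qed
  ultimately show "?xs \<in> {xs \<in> inversion_tables n. missing_descents xs = {}}" by blast
next
  fix xs assume xs: "xs \<in> {xs \<in> inversion_tables n. missing_descents xs = {}}"
  then have len: "length xs = n" and le: "\<And>i. i < n \<Longrightarrow> xs ! i \<le> i"
    by (auto simp: inversion_tables_def)
  \<comment> \<open>The only factorial order with the prescribed predecessor numbers.\<close>
  define P where "P = {(i, j). 1 \<le> i \<and> j \<in> {1..n} \<and> i \<le> xs ! (j - 1)}"
  have lt: "i < j" if "(i, j) \<in> P" for i j
    using that le[of "j - 1"] by (cases j) (auto simp: P_def Suc_le_eq)
  have "i \<in> {1..n}" "j \<in> {1..n}" if "(i, j) \<in> P" for i j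
    using lt[OF that] that by (auto simp: P_def)
  then have "P \<subseteq> {1..n} \<times> {1..n}" by auto
  moreover have "irrefl P" using lt by (auto simp: irrefl_def)
  moreover have "trans P"
  proof (rule transI)
    fix i j k assume "(i, j) \<in> P" "(j, k) \<in> P"
    then show "(i, k) \<in> P" using lt[of i j] by (auto simp: P_def)
  qed
  moreover have "(i, k) \<in> P" if "i \<in> {1..n}" "i < j" "(j, k) \<in> P" for i j k
    using that by (auto simp: P_def)
  ultimately have fac: "factorial_poset n P"
    using lt unfolding factorial_poset_def strict_poset_on_def naturally_labeled_def by blast
  have npred: "npred P (Suc j) = xs ! j" if "j < n" for j
  proof -
    have "{i. (i, Suc j) \<in> P} = {1..xs ! j}"
      using that by (auto simp: P_def)
    then show ?thesis by (simp add: npred_def)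
  qed
  have map: "xs = map (npred P) [1..<Suc n]"
    by (rule nth_equalityI) (auto simp: len npred simp del: upt_Suc)
  have "npred P i \<le> npred P (i + 1) \<or> nsucc P i > nsucc P (i + 1)" if i: "i \<in> {1..n - 1}" for i
  proof (rule ccontr)
    assume neg: "\<not> ?thesis"
    then have "i \<notin> npred P ` {1..n}"
      using nsucc_gt_Suc_iff[OF fac i] by auto
    then have "i \<notin> set xs"
      unfolding map by (simp add: atLeastLessThanSuc_atLeastAtMost del: upt_Suc)
    moreover have "xs ! i < xs ! (i - 1)" "i \<in> {1..<n}"
      using neg npred[of i] npred[of "i - 1"] i by auto
    ultimately have "i \<in> missing_descents xs"
      by (simp add: missing_descents_def len)
    with xs show False by simp
  qed
  with fac map show "\<exists>P\<in>fishburn_factorial_posets n. xs = map (npred P) [1..<Suc n]"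
    unfolding fishburn_factorial_posets_def by blast
qed

section \<open>Inclusion and exclusion over missing descents\<close>

definition tables_missing :: "nat \<Rightarrow> nat set \<Rightarrow> nat list set" where
  "tables_missing n S = {xs \<in> inversion_tables n. S \<subseteq> missing_descents xs}"

text \<open>
  A table is counted with weight \<open>\<Sum>S\<subseteq>M. (-1)^card S\<close>, where \<open>M\<close> is its set of missing descents,
  and this alternating sum vanishes unless \<open>M\<close> is empty.
\<close>
lemma card_tables_without_missing_descents:
  "int (card {xs \<in> inversion_tables n. missing_descents xs = {}}) =
     (\<Sum>S\<in>Pow {1..<n}. (-1) ^ card S * int (card (tables_missing n S)))"
proof -
  have sign: "(\<Sum>S\<in>Pow A. (-1 :: int) ^ card S) = (if A = {} then 1 else 0)" if "finite A" for A :: "nat set"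
    using prod_add[OF that, of "\<lambda>_. -1 :: int" "\<lambda>_. 1"] that by (simp add: power_0_left)
  have "(\<Sum>S\<in>Pow {1..<n}. (-1) ^ card S * int (card (tables_missing n S))) =
      (\<Sum>S\<in>Pow {1..<n}. \<Sum>xs\<in>{xs \<in> inversion_tables n. S \<subseteq> missing_descents xs}. (-1) ^ card S)"
    by (simp add: tables_missing_def mult.commute)
  also have "\<dots> = (\<Sum>xs\<in>inversion_tables n. \<Sum>S | S \<in> Pow {1..<n} \<and> S \<subseteq> missing_descents xs. (-1) ^ card S)"
    by (rule sum.swap_restrict) (auto simp: finite_inversion_tables)
  also have "\<dots> = (\<Sum>xs\<in>inversion_tables n. \<Sum>S\<in>Pow (missing_descents xs). (-1) ^ card S)"
    by (intro sum.cong) (auto simp: inversion_tables_def missing_descents_def)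
  also have "\<dots> = (\<Sum>xs\<in>inversion_tables n. if missing_descents xs = {} then 1 else 0)"
    by (intro sum.cong refl sign) (auto simp: missing_descents_def)
  also have "\<dots> = int (card {xs \<in> inversion_tables n. missing_descents xs = {}})"
    by (simp add: sum.If_cases finite_inversion_tables Collect_conj_eq)
  finally show ?thesis by simp
qed

section \<open>Splitting off the last block\<close>

definition decreasing_lists :: "nat set \<Rightarrow> nat \<Rightarrow> nat list set" where
  "decreasing_lists V s = {ys. sorted_wrt (>) ys \<and> set ys \<subseteq> V \<and> length ys = s}"

lemma card_decreasing_lists:
  assumes "finite V"
  shows "card (decreasing_lists V s) = card V choose s"
proof -
  have "bij_betw set (decreasing_lists V s) {B. B \<subseteq> V \<and> card B = s}"
  proof (rule bij_betw_byWitness[where f' = "\<lambda>B. rev (sorted_list_of_set B)"])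
    show "\<forall>ys\<in>decreasing_lists V s. rev (sorted_list_of_set (set ys)) = ys"
    proof
      fix ys assume "ys \<in> decreasing_lists V s"
      then have "sorted_wrt (<) (rev ys)"
        by (simp add: decreasing_lists_def sorted_wrt_rev)
      then show "rev (sorted_list_of_set (set ys)) = ys"
        using strict_sorted_equal[of "sorted_list_of_set (set ys)" "rev ys"]
        by (simp add: rev_swap)
    qed
    show "\<forall>B\<in>{B. B \<subseteq> V \<and> card B = s}. set (rev (sorted_list_of_set B)) = B"
      using finite_subset[OF _ assms] by simp
    show "set ` decreasing_lists V s \<subseteq> {B. B \<subseteq> V \<and> card B = s}"
    proof -
      have "card (set ys) = length ys" if "sorted_wrt (>) ys" for ys :: "nat list"
        using that by (intro distinct_card) (induction ys; auto)
      then show ?thesis by (auto simp: decreasing_lists_def)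
    qed
    show "(\<lambda>B. rev (sorted_list_of_set B)) ` {B. B \<subseteq> V \<and> card B = s} \<subseteq> decreasing_lists V s"
    proof (safe)
      fix B assume "B \<subseteq> V"
      then show "rev (sorted_list_of_set B) \<in> decreasing_lists V (card B)"
        using finite_subset[OF _ assms]
        by (auto simp: decreasing_lists_def sorted_wrt_rev)
    qed
  qed
  then show ?thesis
    using n_subsets[OF assms] by (simp add: bij_betw_same_card)
qed

text \<open>
  The positions \<open>k, \<dots>, n - 1\<close> form the last block of \<open>S \<union> {k<..<n}\<close>. Its entries decrease from
  one that is at most \<open>k\<close>, and must avoid \<open>S\<close>; the numbers
  \<open>k + 1, \<dots>, n - 1\<close> are then avoided automatically, also by the entries of \<open>xs\<close>, which are below \<open>k\<close>.
\<close>
lemma append_in_tables_missing_iff: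
  assumes S: "S \<subseteq> {1..<k}" and k: "k < n" and len: "length xs = k" "length ys = n - k"
  shows "xs @ ys \<in> tables_missing n (S \<union> {k<..<n}) \<longleftrightarrow>
    xs \<in> tables_missing k S \<and> ys \<in> decreasing_lists ({..k} - S) (n - k)"
proof -
  \<comment> \<open>Writing the length as \<open>length zs\<close> removes it as a separate condition.\<close>
  have mem: "zs \<in> tables_missing (length zs) T \<longleftrightarrow> (\<forall>i<length zs. zs ! i \<le> i) \<and>
      (\<forall>i\<in>T. 1 \<le> i \<and> i < length zs \<and> zs ! i < zs ! (i - 1)) \<and> set zs \<inter> T = {}" for zs T
    by (auto simp: tables_missing_def inversion_tables_def missing_descents_def)
  have n: "length (xs @ ys) = n" using k len by simp
  have nth1: "(xs @ ys) ! i = xs ! i" if "i < k" for i using that len by (simp add: nth_append)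
  have nth2: "(xs @ ys) ! (k + i) = ys ! i" for i using len by (simp add: nth_append)
  have dec: "sorted_wrt (>) ys \<longleftrightarrow> (\<forall>i. Suc i < n - k \<longrightarrow> ys ! i > ys ! Suc i)"
    using len by (subst sorted_wrt_iff_nth_Suc_transp) (auto simp: transp_on_def)
  show ?thesis
  proof
    assume L: "xs @ ys \<in> tables_missing n (S \<union> {k<..<n})"
    note L' = L[folded n, unfolded mem, unfolded n]
    have "ys ! Suc i < ys ! i" if "Suc i < n - k" for i
    proof -
      have "k + Suc i \<in> S \<union> {k<..<n}" using that by auto
      then have "(xs @ ys) ! (k + Suc i) < (xs @ ys) ! (k + Suc i - 1)" using L' by blast
      then show ?thesis using nth2[of i] nth2[of "Suc i"] by simp
    qed
    then have dec': "sorted_wrt (>) ys" by (simp add: dec)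
    have "y \<le> k" if y: "y \<in> set ys" for y
    proof -
      have "ys ! 0 \<le> k" using L' k nth2[of 0] by auto
      moreover have "y \<le> ys ! 0" using y dec' by (cases ys) auto
      ultimately show ?thesis by simp
    qed
    then have "ys \<in> decreasing_lists ({..k} - S) (n - k)"
      using dec' L' len by (auto simp: decreasing_lists_def)
    moreover have "xs \<in> tables_missing (length xs) S"
      unfolding mem unfolding len
    proof (intro conjI allI ballI impI)
      fix i assume "i < k"
      then have "i < n" "(xs @ ys) ! i = xs ! i" using k nth1 by auto
      then show "xs ! i \<le> i" using L' by metis
    next
      fix i assume i: "i \<in> S"
      then have "i < k" "1 \<le> i" using S by auto
      moreover have "(xs @ ys) ! i < (xs @ ys) ! (i - 1)" using L' i by blast
      ultimately show "1 \<le> i" "i < k" "xs ! i < xs ! (i - 1)"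
        using nth1[of i] nth1[of "i - 1"] by auto
    next
      show "set xs \<inter> S = {}" using L' by auto
    qed
    ultimately show "xs \<in> tables_missing k S \<and> ys \<in> decreasing_lists ({..k} - S) (n - k)"
      using len by simp
  next
    assume R: "xs \<in> tables_missing k S \<and> ys \<in> decreasing_lists ({..k} - S) (n - k)"
    then have ys: "sorted_wrt (>) ys" "set ys \<subseteq> {..k} - S"
      by (auto simp: decreasing_lists_def)
    have xs: "\<And>i. i < k \<Longrightarrow> xs ! i \<le> i" "\<And>i. i \<in> S \<Longrightarrow> xs ! i < xs ! (i - 1)" "set xs \<inter> S = {}"
      using R mem[of xs S] len by auto
    have "xs @ ys \<in> tables_missing (length (xs @ ys)) (S \<union> {k<..<n})"
      unfolding mem unfolding n
    proof (intro conjI allI ballI impI)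
      fix i assume i: "i < n"
      show "(xs @ ys) ! i \<le> i"
      proof (cases "i < k")
        case False
        then have "i - k < length ys" using i len by auto
        then have "ys ! (i - k) \<in> {..k} - S" using ys(2) nth_mem by blast
        then show ?thesis using False nth2[of "i - k"] by simp
      qed (simp add: nth1 xs)
    next
      fix i assume i: "i \<in> S \<union> {k<..<n}"
      show "1 \<le> i" "i < n" using i S k by auto
      show "(xs @ ys) ! i < (xs @ ys) ! (i - 1)"
      proof (cases "i \<in> S")
        case True
        then have "i < k" using S by auto
        then have "i < k" "i - 1 < k" by simp_all
        then show ?thesis using xs(2)[OF True] nth1 by simp
      next
        case False
        then have "k < i" using i by simp
        then obtain j where j: "i = k + Suc j" by (auto dest: less_imp_Suc_add)
        then have "ys ! j > ys ! Suc j"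
          using i False ys(1) dec by auto
        then show ?thesis using nth2[of j] nth2[of "Suc j"] by (simp add: j)
      qed
    next
      have "x < k" if x: "x \<in> set xs" for x
      proof -
        obtain i where "i < k" "x = xs ! i" using x len by (auto simp: in_set_conv_nth)
        then show ?thesis using xs(1)[of i] by simp
      qed
      then show "set (xs @ ys) \<inter> (S \<union> {k<..<n}) = {}" using xs(3) ys(2) by fastforce
    qed
    then show "xs @ ys \<in> tables_missing n (S \<union> {k<..<n})" unfolding n .
  qed
qed

lemma card_tables_missing_Un:
  assumes S: "S \<subseteq> {1..<k}" and k: "k < n"
  shows "card (tables_missing n (S \<union> {k<..<n})) =
    card (tables_missing k S) * ((k + 1 - card S) choose (n - k))"
proof -
  let ?D = "decreasing_lists ({..k} - S) (n - k)"
  have len: "length xs = m" if "xs \<in> tables_missing m T" for xs m T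
    using that by (auto simp: tables_missing_def inversion_tables_def)
  have "bij_betw (\<lambda>(xs, ys). xs @ ys) (tables_missing k S \<times> ?D) (tables_missing n (S \<union> {k<..<n}))"
  proof (rule bij_betw_byWitness[where f' = "\<lambda>zs. (take k zs, drop k zs)"])
    show "\<forall>p\<in>tables_missing k S \<times> ?D. (\<lambda>zs. (take k zs, drop k zs)) ((\<lambda>(xs, ys). xs @ ys) p) = p"
      using len by fastforce
    show "(\<lambda>(xs, ys). xs @ ys) ` (tables_missing k S \<times> ?D) \<subseteq> tables_missing n (S \<union> {k<..<n})"
      using append_in_tables_missing_iff[OF S k] len by (auto simp: decreasing_lists_def)
    show "(\<lambda>zs. (take k zs, drop k zs)) ` tables_missing n (S \<union> {k<..<n}) \<subseteq> tables_missing k S \<times> ?D"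
    proof (intro image_subsetI)
      fix zs assume zs: "zs \<in> tables_missing n (S \<union> {k<..<n})"
      then show "(take k zs, drop k zs) \<in> tables_missing k S \<times> ?D"
        using append_in_tables_missing_iff[OF S k, of "take k zs" "drop k zs"] len[OF zs] k by simp
    qed
  qed simp
  then have "card (tables_missing n (S \<union> {k<..<n})) = card (tables_missing k S \<times> ?D)"
    by (metis bij_betw_same_card)
  moreover have "card ({..k} - S) = k + 1 - card S"
    using S by (subst card_Diff_subset) (auto intro: finite_subset)
  ultimately show ?thesis
    by (simp add: card_cartesian_product card_decreasing_lists)
qed

section \<open>The generating function\<close>

text \<open>
  The condition \<open>card S + m = n\<close> says that \<open>S\<close> cuts the \<open>n\<close> positions into \<open>m\<close> blocks.
\<close>
definition signed_count :: "nat \<Rightarrow> nat \<Rightarrow> int" where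
  "signed_count m n = (\<Sum>S | S \<subseteq> {1..<n} \<and> card S + m = n.
     (-1) ^ card S * int (card (tables_missing n S)))"

text \<open>
  The last block starts after the largest number \<open>k < n\<close> outside the set; the number \<open>0\<close>, which is never
  in the set, ensures that \<open>k\<close> exists. What remains below \<open>k\<close> describes the other blocks.
\<close>
lemma bij_betw_last_block:
  "bij_betw (\<lambda>(k, S). S \<union> {k<..<n})
     (SIGMA k:{..<n}. {S. S \<subseteq> {1..<k} \<and> card S + m = k})
     {S. S \<subseteq> {1..<n} \<and> card S + Suc m = n}"
  unfolding bij_betw_def
proof (intro conjI)
  show "inj_on (\<lambda>(k, S). S \<union> {k<..<n}) (SIGMA k:{..<n}. {S. S \<subseteq> {1..<k} \<and> card S + m = k})"
  proof (rule inj_onI)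
    fix p q
    assume pq: "p \<in> (SIGMA k:{..<n}. {S. S \<subseteq> {1..<k} \<and> card S + m = k})"
      "q \<in> (SIGMA k:{..<n}. {S. S \<subseteq> {1..<k} \<and> card S + m = k})"
      "(case p of (k, S) \<Rightarrow> S \<union> {k<..<n}) = (case q of (k, S) \<Rightarrow> S \<union> {k<..<n})"
    obtain k S where [simp]: "p = (k, S)" by (cases p)
    obtain l T where [simp]: "q = (l, T)" by (cases q)
    have S: "k \<in> {..<n}" "S \<subseteq> {1..<k}" and T: "l \<in> {..<n}" "T \<subseteq> {1..<l}"
      and eq: "S \<union> {k<..<n} = T \<union> {l<..<n}"
      using pq by auto
    have "k = l"
    proof (rule linorder_cases[of k l])
      assume "k < l"
      then have "l \<in> S \<union> {k<..<n}" using T by auto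
      moreover have "l \<notin> T \<union> {l<..<n}" using T by auto
      ultimately show ?thesis using eq by blast
    next
      assume "l < k"
      then have "k \<in> T \<union> {l<..<n}" using S by auto
      moreover have "k \<notin> S \<union> {k<..<n}" using S by auto
      ultimately show ?thesis using eq by blast
    qed
    moreover have "S = (S \<union> {k<..<n}) \<inter> {..<k}" "T = (T \<union> {l<..<n}) \<inter> {..<l}"
      using S T by auto
    ultimately show "p = q"
      using eq by simp
  qed
  have card_Un: "card (S \<union> {k<..<n}) + Suc m = n \<longleftrightarrow> card S + m = k"
    if "k < n" "S \<subseteq> {1..<k}" for k S
  proof -
    have "finite S" using that(2) finite_subset by blast
    then have "card (S \<union> {k<..<n}) = card S + (n - k - 1)"
      using that(2) by (subst card_Un_disjoint) auto
    then show ?thesis using that(1) by auto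
  qed
  show "(\<lambda>(k, S). S \<union> {k<..<n}) ` (SIGMA k:{..<n}. {S. S \<subseteq> {1..<k} \<and> card S + m = k}) =
      {S. S \<subseteq> {1..<n} \<and> card S + Suc m = n}"
  proof (intro subset_antisym subsetI)
    fix T assume "T \<in> {S. S \<subseteq> {1..<n} \<and> card S + Suc m = n}"
    then have T: "T \<subseteq> {1..<n}" "card T + Suc m = n" by auto
    define k where "k = Max ({..<n} - T)"
    have "0 \<in> {..<n} - T" using T by auto
    then have k: "k \<in> {..<n} - T"
      unfolding k_def by (intro Max_in) auto
    have above: "i \<in> T" if "k < i" "i < n" for i
    proof (rule ccontr)
      assume "i \<notin> T"
      then have "i \<le> k" unfolding k_def using that by (intro Max_ge) auto
      with that show False by simp
    qed
    have "T = (T \<inter> {..<k}) \<union> {k<..<n}"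
    proof (rule set_eqI)
      fix x
      show "x \<in> T \<longleftrightarrow> x \<in> (T \<inter> {..<k}) \<union> {k<..<n}"
        by (rule linorder_cases[of x k]) (use T(1) k above[of x] in auto)
    qed
    moreover have sub: "T \<inter> {..<k} \<subseteq> {1..<k}" using T by auto
    moreover have "card (T \<inter> {..<k}) + m = k"
      using card_Un[OF _ sub] k T(2) calculation(1) by simp
    ultimately show "T \<in> (\<lambda>(k, S). S \<union> {k<..<n}) `
        (SIGMA k:{..<n}. {S. S \<subseteq> {1..<k} \<and> card S + m = k})"
      using k by (auto intro!: image_eqI[of _ _ "(k, T \<inter> {..<k})"])
  next
    fix T assume "T \<in> (\<lambda>(k, S). S \<union> {k<..<n}) `
        (SIGMA k:{..<n}. {S. S \<subseteq> {1..<k} \<and> card S + m = k})"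
    then obtain k S where kS: "k < n" "S \<subseteq> {1..<k}" "card S + m = k" "T = S \<union> {k<..<n}"
      by auto
    have "T \<subseteq> {1..<n}" unfolding kS(4) using kS(1,2) by auto
    moreover have "card T + Suc m = n" unfolding kS(4) using card_Un[OF kS(1,2)] kS(3) by blast
    ultimately show "T \<in> {S. S \<subseteq> {1..<n} \<and> card S + Suc m = n}" by blast
  qed
qed

lemma nth_one_minus_X_power:
  "fps_nth ((1 - fps_X) ^ j :: int fps) d = (-1) ^ d * int (j choose d)"
proof (induction j arbitrary: d)
  case 0
  then show ?case by (cases d) auto
next
  case (Suc j)
  have "(1 - fps_X :: int fps) ^ Suc j = (1 - fps_X) ^ j - fps_X * (1 - fps_X) ^ j"
    by (simp add: algebra_simps)
  then show ?case
    using Suc by (cases d) (simp_all add: algebra_simps)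
qed

text \<open>
  Let the last of \<open>m + 1\<close> blocks have length \<open>d = n - k\<close>. It adds \<open>d - 1\<close> elements to the
  set, hence the sign \<open>(-1)^(d-1)\<close>, and multiplies the number of tables by
  \<open>m + 1 choose d\<close>. The product of these two is the coefficient of \<open>t^d\<close> in \<open>1 - (1 - t)^(m+1)\<close>, so that the recursion for
  \<open>signed_count\<close> is multiplication by this factor.
\<close>
lemma signed_count_eq:
  "signed_count m n = fps_nth (\<Prod>i=1..m. (1 - (1 - fps_X) ^ i)) n"
proof (induction m arbitrary: n)
  case 0
  have "{S. S \<subseteq> {1..<n} \<and> card S = n} = (if n = 0 then {{}} else {})"
  proof (cases "n = 0")
    case False
    have "card S < n" if "S \<subseteq> {1..<n}" for S
      using card_mono[OF _ that] False by simp
    with False show ?thesis by (auto simp: less_imp_neq)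
  qed auto
  moreover have "tables_missing 0 {} = {[]}"
    by (auto simp: tables_missing_def inversion_tables_def)
  ultimately show ?case by (simp add: signed_count_def)
next
  case (Suc m)
  let ?w = "\<lambda>n S. (-1) ^ card S * int (card (tables_missing n S))"
  let ?c = "\<lambda>d. (-1) ^ (d - 1) * int (Suc m choose d)"
  have fin: "finite {S. S \<subseteq> {1..<k} \<and> card S + m = k}" for k
    by (rule finite_subset[of _ "Pow {1..<k}"]) auto
  have step: "?w n (S \<union> {k<..<n}) = ?w k S * ?c (n - k)"
    if "k < n" "S \<subseteq> {1..<k}" "card S + m = k" for k S
  proof -
    have "finite S" using that(2) finite_subset by blast
    then have "card (S \<union> {k<..<n}) = card S + (n - k - 1)"
      using that(2) by (subst card_Un_disjoint) auto
    moreover have "k + 1 - card S = Suc m" using that(3) by simp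
    ultimately show ?thesis
      using card_tables_missing_Un[OF that(2,1)] by (simp add: power_add)
  qed
  have "signed_count (Suc m) n =
      (\<Sum>(k, S)\<in>(SIGMA k:{..<n}. {S. S \<subseteq> {1..<k} \<and> card S + m = k}). ?w n (S \<union> {k<..<n}))"
    unfolding signed_count_def
    by (subst sum.reindex_bij_betw[OF bij_betw_last_block, symmetric]) (simp add: case_prod_unfold)
  also have "\<dots> = (\<Sum>(k, S)\<in>(SIGMA k:{..<n}. {S. S \<subseteq> {1..<k} \<and> card S + m = k}). ?w k S * ?c (n - k))"
    by (intro sum.cong refl) (use step in auto)
  also have "\<dots> = (\<Sum>k<n. signed_count m k * ?c (n - k))"
    unfolding signed_count_def sum_distrib_right using fin by (subst sum.Sigma) auto
  also have "\<dots> = (\<Sum>k<n. signed_count m k * fps_nth (1 - (1 - fps_X) ^ Suc m) (n - k))"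
  proof (intro sum.cong refl)
    fix k assume "k \<in> {..<n}"
    then obtain d where "n - k = Suc d" by (cases "n - k") auto
    then show "signed_count m k * ?c (n - k) =
        signed_count m k * fps_nth (1 - (1 - fps_X) ^ Suc m) (n - k)"
      by (simp add: nth_one_minus_X_power del: power_Suc binomial_Suc_Suc) simp
  qed
  also have "\<dots> = (\<Sum>k=0..n. signed_count m k * fps_nth (1 - (1 - fps_X) ^ Suc m) (n - k))"
    by (intro sum.mono_neutral_left)
      (auto simp: not_less nth_one_minus_X_power simp del: power_Suc)
  also have "\<dots> = fps_nth (\<Prod>i=1..Suc m. (1 - (1 - fps_X) ^ i)) n"
    by (simp add: fps_mult_nth Suc.IH)
  finally show ?case .
qed

text \<open>
  Convergence of formal power series means that each coefficient is eventually constant, and the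
  \<open>m\<close>-th summand is divisible by the \<open>m\<close>-th power of the variable.
\<close>
lemma fishburn_eq_sum:
  "fishburn n = (\<Sum>m\<le>n. fps_nth (\<Prod>i=1..m. (1 - (1 - fps_X) ^ i)) n)"
proof -
  let ?g = "\<lambda>m. \<Prod>i=1..m. (1 - (1 - fps_X :: int fps) ^ i)"
  have "(\<lambda>N. \<Sum>m<N. ?g m) \<longlonglongrightarrow> fishburn_fps"
    unfolding fishburn_fps_def using summable_LIMSEQ[OF summable_fishburn] .
  then have "eventually (\<lambda>N. fps_nth (\<Sum>m<N. ?g m) n = fishburn n) sequentially"
    unfolding tendsto_fps_iff fishburn_def by blast
  with eventually_gt_at_top[of n]
  have "eventually (\<lambda>N. n < N \<and> fps_nth (\<Sum>m<N. ?g m) n = fishburn n) sequentially"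
    by eventually_elim simp
  then obtain N where N: "n < N" "fps_nth (\<Sum>m<N. ?g m) n = fishburn n"
    by (auto simp: eventually_sequentially)
  have "fishburn n = (\<Sum>m<N. fps_nth (?g m) n)"
    using N(2) by (simp add: fps_sum_nth)
  also have "\<dots> = (\<Sum>m\<le>n. fps_nth (?g m) n)"
    using N(1) fishburn_summand_nth_eq_0 by (intro sum.mono_neutral_right) auto
  finally show ?thesis .
qed

theorem card_fishburn_factorial_posets:
  "int (card (fishburn_factorial_posets n)) = fishburn n"
proof -
  let ?w = "\<lambda>S. (-1) ^ card S * int (card (tables_missing n S))"
  have card_le: "card S \<le> n" if "S \<subseteq> {1..<n}" for S
    using card_mono[OF _ that] by simp
  have "int (card (fishburn_factorial_posets n)) = (\<Sum>S\<in>Pow {1..<n}. ?w S)"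
    using bij_betw_same_card[OF bij_betw_fishburn_inversion_tables]
      card_tables_without_missing_descents by simp
  also have "\<dots> = (\<Sum>m\<le>n. \<Sum>S | S \<in> Pow {1..<n} \<and> n - card S = m. ?w S)"
    by (rule sum.group[symmetric]) auto
  also have "\<dots> = (\<Sum>m\<le>n. signed_count m n)"
    unfolding signed_count_def by (intro sum.cong refl) (use card_le in auto)
  finally show ?thesis
    by (simp add: signed_count_eq fishburn_eq_sum)
qed

theorem proposition6:
  fixes n :: nat
  assumes "n \<ge> 1"
  shows "(\<exists>\<phi>. bij_betw \<phi> (fishburn_factorial_posets n) (unlabeled_two_plus_two_free_posets n)) \<and>
         int (card (fishburn_factorial_posets n)) = fishburn n"
  using fishburn_factorial_posets_bij_unlabeled card_fishburn_factorial_posets by blast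

end
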